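(* Consider the biobjective mixed-integer linear program of minimizing $\boldsymbol f(x)=(f_1(x),f_2(x))$, $f_k(x)=\sum_j c^k_jx_j$, over $X_I$, with set of nondominated points $Y_N$ (all as defined in the context). Suppose there exists an index $j$ with $c^k_j\ge 0$ and $a_{ij}\ge 0$ for all $k\in\{1,2\}$ and all rows $i$ of $A$. Then $Y_N\subseteq \boldsymbol f(\{x\in X_I : x_j=l_j\})$. Similarly, if there exists an index $j$ with $c^k_j\le 0$ and $a_{ij}\le 0$ for all $k\in\{1,2\}$ and all rows $i$ of $A$, then $Y_N\subseteq \boldsymbol f(\{x\in X_I : x_j=u_j\})$.
   Context: Let $X_I=\{x\in\mathbb Z^n_{+}\times\mathbb R^p_{+} : Ax\le b,\ l_i\le x_i\le u_i\ \forall i\}$, where $A=(a_{ij})$ is a real matrix and $b$ a real vector. The only assumption on the model is that $X_I\neq\emptyset$ and $-\infty<l_i<u_i<+\infty$ for all $i$. The two objectives are $f_k(x)=(c^k)^{\mathsf T}x$, $k=1,2$, where $c^k\in\mathbb R^{n+p}$ has $j$-th entry $c^k_j$, and $\boldsymbol f(x)=(f_1(x),f_2(x))\in\mathbb R^2$. For $y,y'\in\mathbb R^2$, $y$ dominates $y'$ (written $y\succ y'$) if $y\le y'$ componentwise. A point $x\in X_I$ is efficient if there is no $x'\in X_I$ with $\boldsymbol f(x')\succ\boldsymbol f(x)$ and $\boldsymbol f(x')\neq\boldsymbol f(x)$. $X_E$ is the set of efficient points and $Y_N=\boldsymbol f(X_E)$ is the set of nondominated (Pareto optimal) points.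
   Formalization: The first part additionally assumes l_j ≥ 0, and l_j integer if x_j is an integer variable; the second part assumes u_j integer if x_j is an integer variable; otherwise no feasible point attains the bound and the claim fails. *)

theory Defs
  imports Jordan_Normal_Form.Matrix
begin

text \<open>Indices start at 0: the variables are numbered by \<open>{0..<n+p}\<close>, the integer ones being
  \<open>{0..<n}\<close>. The bounds \<open>l\<close>, \<open>u\<close> are arbitrary reals here: \<open>l $ j\<close> may be negative, and \<open>l $ j\<close> or
  \<open>u $ j\<close> may be fractional although \<open>j < n\<close>. Then no feasible point attains that bound, so a
  statement fixing a variable at a bound has to exclude this.\<close>

definition feasible_set ::
    "nat \<Rightarrow> nat \<Rightarrow> real mat \<Rightarrow> real vec \<Rightarrow> real vec \<Rightarrow> real vec \<Rightarrow> real vec set" where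
  "feasible_set n p A b l u =
     {x \<in> carrier_vec (n + p).
        (\<forall>i<n. x $ i \<in> \<int>) \<and> (\<forall>i<n + p. 0 \<le> x $ i) \<and>
        A *\<^sub>v x \<le> b \<and>
        (\<forall>i<n + p. l $ i \<le> x $ i \<and> x $ i \<le> u $ i)}"

text \<open>Only the values of \<open>c\<close> at 1 and 2 matter: \<open>c k\<close> is the cost vector of the \<open>k\<close>-th objective.\<close>

definition objective :: "(nat \<Rightarrow> real vec) \<Rightarrow> real vec \<Rightarrow> real \<times> real" where
  "objective c x = (c 1 \<bullet> x, c 2 \<bullet> x)"

text \<open>Dominance is the weak (reflexive) componentwise order, for minimization.\<close>

definition dominates :: "real \<times> real \<Rightarrow> real \<times> real \<Rightarrow> bool" where
  "dominates y y' \<longleftrightarrow> fst y \<le> fst y' \<and> snd y \<le> snd y'"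

definition efficient_set :: "(real vec \<Rightarrow> real \<times> real) \<Rightarrow> real vec set \<Rightarrow> real vec set" where
  "efficient_set f X = {x \<in> X. \<not> (\<exists>x'\<in>X. dominates (f x') (f x) \<and> f x' \<noteq> f x)}"

definition nondominated_set ::
    "(real vec \<Rightarrow> real \<times> real) \<Rightarrow> real vec set \<Rightarrow> (real \<times> real) set" where
  "nondominated_set f X = f ` efficient_set f X"

end

theory Submission
  imports Defs
begin

text \<open>Moving the coordinate \<open>x $ j\<close> of an efficient point to its bound preserves feasibility and
  increases no objective, so by efficiency it leaves both objective values unchanged.\<close>

definition vec_upd :: "'a vec \<Rightarrow> nat \<Rightarrow> 'a \<Rightarrow> 'a vec" where
  "vec_upd x j t = vec (dim_vec x) (\<lambda>i. if i = j then t else x $ i)"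

lemma dim_vec_upd [simp]: "dim_vec (vec_upd x j t) = dim_vec x"
  by (simp add: vec_upd_def)

lemma index_vec_upd [simp]:
  "i < dim_vec x \<Longrightarrow> vec_upd x j t $ i = (if i = j then t else x $ i)"
  by (simp add: vec_upd_def)

text \<open>The two sums differ only in the summand at \<open>j\<close>. The sign of
  \<open>(t - x $ j) * v $ j\<close> therefore decides whether the update raises or lowers the
  value; this is used with \<open>v\<close> a row of \<open>A\<close> and with \<open>v\<close> a
  cost vector.\<close>

lemma scalar_prod_vec_upd:
  fixes v x :: "'a :: comm_ring vec"
  assumes "j < dim_vec x"
  shows "v \<bullet> vec_upd x j t = v \<bullet> x + (t - x $ j) * v $ j"
proof -
  have "v \<bullet> vec_upd x j t - v \<bullet> x =
      (\<Sum>i = 0..<dim_vec x. if i = j then (t - x $ j) * v $ j else 0)"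
    \<comment> \<open>\<open>scalar_prod\<close> sums over the indices of its second argument, and
      \<open>vec_upd\<close> keeps the dimension, so both sums have the same range and can be
      subtracted termwise.\<close>
    unfolding scalar_prod_def dim_vec_upd sum_subtractf [symmetric]
    by (rule sum.cong) (auto simp: algebra_simps)
  also have "\<dots> = (t - x $ j) * v $ j"
    using assms by simp
  finally show ?thesis
    by (simp add: algebra_simps)
qed

text \<open>Bounds and integrality have to be checked only at the changed coordinate. Row
  \<open>i\<close> of the product changes by \<open>(t - x $ j) * A $$ (i, j)\<close>, so
  \<open>col\<close> keeps every constraint below its old value, hence below
  \<open>b\<close>.\<close>

lemma feasible_set_vec_upd:
  assumes A: "A \<in> carrier_mat m (n + p)"
    and x: "x \<in> feasible_set n p A b l u"
    and j: "j < n + p"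
    and t: "0 \<le> t" "l $ j \<le> t" "t \<le> u $ j" "j < n \<Longrightarrow> t \<in> \<int>"
    and col: "\<And>i. i < m \<Longrightarrow> (t - x $ j) * A $$ (i, j) \<le> 0"
  shows "vec_upd x j t \<in> feasible_set n p A b l u"
proof -
  have dim: "dim_vec x = n + p"
    using x by (auto simp: feasible_set_def)
  have int: "\<And>i. i < n \<Longrightarrow> x $ i \<in> \<int>"
    and bnd: "\<And>i. i < n + p \<Longrightarrow> 0 \<le> x $ i \<and> l $ i \<le> x $ i \<and> x $ i \<le> u $ i"
    using x unfolding feasible_set_def by blast+
  have le: "A *\<^sub>v vec_upd x j t \<le> A *\<^sub>v x"
    using A j dim col by (auto simp: less_eq_vec_def scalar_prod_vec_upd)
  show ?thesis
    unfolding feasible_set_def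
  proof (intro CollectI conjI)
    show "vec_upd x j t \<in> carrier_vec (n + p)"
      by (rule carrier_vecI) (simp add: dim)
    \<comment> \<open>In the case \<open>i = j\<close> the bound \<open>i < n\<close> becomes the
      premise \<open>j < n\<close> of \<open>t(4)\<close>.\<close>
    show "\<forall>i<n. vec_upd x j t $ i \<in> \<int>"
      using int t(4) dim by simp
    show "\<forall>i<n + p. 0 \<le> vec_upd x j t $ i"
      using bnd t(1) dim by simp
    have "A *\<^sub>v x \<le> b"
      using x by (simp add: feasible_set_def)
    with le show "A *\<^sub>v vec_upd x j t \<le> b"
      by (rule order_trans)
    show "\<forall>i<n + p. l $ i \<le> vec_upd x j t $ i \<and> vec_upd x j t $ i \<le> u $ i"
      using bnd t(2,3) dim by simp
  qed
qed

text \<open>Common form of both claims, with \<open>t\<close> the lower or the upper bound. Stating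
  the signs through products with \<open>t - x $ j\<close> covers a move down along nonnegative
  coefficients and a move up along nonpositive ones. The range condition on \<open>t\<close> may use
  a feasible \<open>x\<close>, which matters for the upper bound.\<close>

lemma nondominated_set_subset_fixed_coordinate:
  assumes A: "A \<in> carrier_mat m (n + p)"
    and j: "j < n + p"
    and t: "\<And>x. x \<in> feasible_set n p A b l u \<Longrightarrow> 0 \<le> t \<and> l $ j \<le> t \<and> t \<le> u $ j"
      "j < n \<Longrightarrow> t \<in> \<int>"
    and col: "\<And>x i. x \<in> feasible_set n p A b l u \<Longrightarrow> i < m \<Longrightarrow> (t - x $ j) * A $$ (i, j) \<le> 0"
    and cost: "\<And>x k. x \<in> feasible_set n p A b l u \<Longrightarrow> k \<in> {1, 2} \<Longrightarrow> (t - x $ j) * c k $ j \<le> 0"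
  shows "nondominated_set (objective c) (feasible_set n p A b l u)
    \<subseteq> objective c ` {x \<in> feasible_set n p A b l u. x $ j = t}"
proof
  fix y assume "y \<in> nondominated_set (objective c) (feasible_set n p A b l u)"
  then obtain x where y: "y = objective c x"
    and x: "x \<in> feasible_set n p A b l u"
    and eff: "\<And>x'. x' \<in> feasible_set n p A b l u \<Longrightarrow>
      dominates (objective c x') (objective c x) \<Longrightarrow> objective c x' = objective c x"
    by (auto simp: nondominated_set_def efficient_set_def)
  let ?x' = "vec_upd x j t"
  have dim: "j < dim_vec x"
    using x j by (auto simp: feasible_set_def)
  have x': "?x' \<in> feasible_set n p A b l u"
    using t x col by (intro feasible_set_vec_upd [OF A x j]) auto
  have "dominates (objective c ?x') (objective c x)"
    using cost [OF x, of 1] cost [OF x, of 2] dim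
    by (simp add: dominates_def objective_def scalar_prod_vec_upd)
  \<comment> \<open>Efficiency turns weak dominance into equality of the images. The point
    \<open>x\<close> itself may have another value at \<open>j\<close>; only its image has to be
    attained with value \<open>t\<close>.\<close>
  then have "y = objective c ?x'"
    using eff [OF x'] y by simp
  with x' dim show "y \<in> objective c ` {x \<in> feasible_set n p A b l u. x $ j = t}"
    by auto
qed

theorem proposition1:
  fixes n p m :: nat
    and A :: "real mat" and b l u :: "real vec" and c :: "nat \<Rightarrow> real vec"
  assumes "A \<in> carrier_mat m (n + p)" and "b \<in> carrier_vec m"
    and "l \<in> carrier_vec (n + p)" and "u \<in> carrier_vec (n + p)"
    and "\<forall>k\<in>{1, 2}. c k \<in> carrier_vec (n + p)"
    and "feasible_set n p A b l u \<noteq> {}"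
    and "\<forall>i<n + p. l $ i < u $ i"
  shows "(\<forall>j<n + p.
           (\<forall>k\<in>{1, 2}. 0 \<le> c k $ j) \<and> (\<forall>i<m. 0 \<le> A $$ (i, j)) \<and>
           0 \<le> l $ j \<and> (j < n \<longrightarrow> l $ j \<in> \<int>) \<longrightarrow>
           nondominated_set (objective c) (feasible_set n p A b l u)
             \<subseteq> objective c ` {x \<in> feasible_set n p A b l u. x $ j = l $ j}) \<and>
         (\<forall>j<n + p.
           (\<forall>k\<in>{1, 2}. c k $ j \<le> 0) \<and> (\<forall>i<m. A $$ (i, j) \<le> 0) \<and>
           (j < n \<longrightarrow> u $ j \<in> \<int>) \<longrightarrow>
           nondominated_set (objective c) (feasible_set n p A b l u)
             \<subseteq> objective c ` {x \<in> feasible_set n p A b l u. x $ j = u $ j})"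
proof (intro conjI allI impI)
  fix j
  assume j: "j < n + p"
    and sign: "(\<forall>k\<in>{1, 2}. 0 \<le> c k $ j) \<and> (\<forall>i<m. 0 \<le> A $$ (i, j)) \<and>
      0 \<le> l $ j \<and> (j < n \<longrightarrow> l $ j \<in> \<int>)"
  have bnd: "l $ j \<le> x $ j" if "x \<in> feasible_set n p A b l u" for x
    using that j by (simp add: feasible_set_def)
  show "nondominated_set (objective c) (feasible_set n p A b l u)
      \<subseteq> objective c ` {x \<in> feasible_set n p A b l u. x $ j = l $ j}"
  proof (rule nondominated_set_subset_fixed_coordinate [OF assms(1) j])
    show "0 \<le> l $ j \<and> l $ j \<le> l $ j \<and> l $ j \<le> u $ j"
      using assms(7) j sign by (simp add: less_imp_le)
    show "l $ j \<in> \<int>" if "j < n"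
      using sign that by blast
    \<comment> \<open>The move goes down: the first factor is nonpositive and the coefficient
      nonnegative.\<close>
    show "(l $ j - x $ j) * A $$ (i, j) \<le> 0"
      if "x \<in> feasible_set n p A b l u" "i < m" for x i
      using bnd [OF that(1)] sign that(2) by (simp add: mult_nonpos_nonneg)
    show "(l $ j - x $ j) * c k $ j \<le> 0"
      if "x \<in> feasible_set n p A b l u" "k \<in> {1, 2}" for x k
      using bnd [OF that(1)] sign that(2) by (meson diff_le_0_iff_le mult_nonpos_nonneg)
  qed
next
  fix j
  assume j: "j < n + p"
    and sign: "(\<forall>k\<in>{1, 2}. c k $ j \<le> 0) \<and> (\<forall>i<m. A $$ (i, j) \<le> 0) \<and>
      (j < n \<longrightarrow> u $ j \<in> \<int>)"
  have bnd: "x $ j \<le> u $ j" "0 \<le> x $ j" if "x \<in> feasible_set n p A b l u" for x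
    using that j by (simp_all add: feasible_set_def)
  show "nondominated_set (objective c) (feasible_set n p A b l u)
      \<subseteq> objective c ` {x \<in> feasible_set n p A b l u. x $ j = u $ j}"
  proof (rule nondominated_set_subset_fixed_coordinate [OF assms(1) j])
    \<comment> \<open>Nonnegativity of the upper bound is read off from a feasible point, since
      \<open>0 \<le> x $ j\<close> and \<open>x $ j \<le> u $ j\<close>; for the lower bound it had
      to be assumed.\<close>
    show "0 \<le> u $ j \<and> l $ j \<le> u $ j \<and> u $ j \<le> u $ j"
      if "x \<in> feasible_set n p A b l u" for x
      using assms(7) j bnd [OF that] by (simp add: less_imp_le)
    show "u $ j \<in> \<int>" if "j < n"
      using sign that by blast
    show "(u $ j - x $ j) * A $$ (i, j) \<le> 0"
      if "x \<in> feasible_set n p A b l u" "i < m" for x i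
      using bnd [OF that(1)] sign that(2) by (simp add: mult_nonneg_nonpos)
    show "(u $ j - x $ j) * c k $ j \<le> 0"
      if "x \<in> feasible_set n p A b l u" "k \<in> {1, 2}" for x k
      using bnd [OF that(1)] sign that(2) by (meson diff_ge_0_iff_ge mult_nonneg_nonpos)
  qed
qed

end
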